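(* Let $n\ge2$ be an integer. (a) The expected number of comparisons of strategy ``Clairvoyant'' in one partitioning step on $n$ elements is $$\mathbb{E}(P^{\mathrm{cv}}_n)=\frac32n-\frac94+\frac{1}{4(n-[n\text{ even}])}-\mathbb{E}(X^{\searrow}_n).$$ (b) The expected number of comparisons of strategy ``Count'' in one partitioning step on $n$ elements is $$\mathbb{E}(P^{\mathrm{ct}}_n)=\frac32n-\frac94+\frac{1}{4(n-[n\text{ even}])}+\mathbb{E}(X^{\nearrow}_n).$$
   Context: $[\mathit{expr}]$ is $1$ if $\mathit{expr}$ is true and $0$ otherwise. Partitioning step: the input $(a_1,\dots,a_n)$ is a uniformly random permutation of $\{1,\dots,n\}$, $n\ge2$. One comparison of $a_1$ and $a_n$ determines the pivots $p=\min(a_1,a_n)$ and $q=\max(a_1,a_n)$; this comparison is counted. The remaining elements $a_2,\dots,a_{n-1}$ are classified one after another as small ($<p$), medium (between $p$ and $q$) or large ($>q$). Each element is compared first with one of the two pivots, as prescribed by the strategy, and then with the other pivot exactly if its class is not yet determined (so medium elements always cost 2 comparisons, small elements cost 1 if compared with $p$ first and 2 otherwise, large elements cost 1 if compared with $q$ first and 2 otherwise). Let $s_i$, $\ell_i$ be the numbers of elements classified as small, respectively large, among the first $i$ classified elements ($s_0=\ell_0=0$), and let $s=p-1$, $\ell=n-q$ be the total numbers of small and large elements. When classifying the $i$th element, $1\le i\le n-2$: - Strategy ``Clairvoyant'' (which knows $s$ and $\ell$ from an oracle): if $s-s_{i-1}\ge\ell-\ell_{i-1}$, compare with $p$ first,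 otherwise compare with $q$ first. - Strategy ``Count'': if $s_{i-1}\ge\ell_{i-1}$, compare with $p$ first, otherwise compare with $q$ first. $P^{\mathrm{cv}}_n$ and $P^{\mathrm{ct}}_n$ are the (random) total numbers of comparisons in the partitioning step (without recursive calls) of ``Clairvoyant'' and ``Count'', respectively. Random lattice paths: a random path of length $n'\ge 0$ on $\mathbb{Z}^2$ with steps $(1,+1)$ and $(1,-1)$ is chosen by first choosing a starting point $(0,S)$ with $S$ uniform in $\{-n',-n'+2,\dots,n'\}$ and then choosing a path uniformly at random among all paths from $(0,S)$ to $(n',0)$. For fixed $n\ge2$, choose $(P,Q)$ with $1\le P<Q\le n$ uniformly at random, let $N'=n-1-(Q-P)$, and choose a random path of length $N'$ in this way. $X^{\nearrow}_n$ is the number of up-to-zero situations on it, i.e. points $(x,0)$ on the path such that $(x-1,-1)$ is on the path; $X^{\searrow}_n$ is the number of down-from-zero situations, i.e. points $(x,0)$ on the path such that $(x+1,-1)$ is on the path. *)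

theory Defs
  imports "HOL-Probability.Probability" "HOL-Combinatorics.Multiset_Permutations"
begin

section \<open>Partitioning with two pivots\<close>

text \<open>
  The input \<open>(a\<^sub>1, \<dots>, a\<^sub>n)\<close> is a list \<open>xs\<close> with \<open>a\<^sub>j = xs ! (j - 1)\<close>; thus the \<open>i\<close>-th classified
  element \<open>a\<^bsub>i+1\<^esub>\<close>, \<open>1 \<le> i \<le> n - 2\<close>, is \<open>xs ! i\<close>.
\<close>

definition pivot_p :: "nat list \<Rightarrow> nat" where
  "pivot_p xs = min (hd xs) (last xs)"

definition pivot_q :: "nat list \<Rightarrow> nat" where
  "pivot_q xs = max (hd xs) (last xs)"

definition small_seen :: "nat list \<Rightarrow> nat \<Rightarrow> nat" where
  "small_seen xs i = card {j \<in> {1..i}. xs ! j < pivot_p xs}"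

definition large_seen :: "nat list \<Rightarrow> nat \<Rightarrow> nat" where
  "large_seen xs i = card {j \<in> {1..i}. xs ! j > pivot_q xs}"

definition small_total :: "nat list \<Rightarrow> nat" where
  "small_total xs = pivot_p xs - 1"

definition large_total :: "nat list \<Rightarrow> nat" where
  "large_total xs = length xs - pivot_q xs"

text \<open>
  A strategy decides, given the input and the index \<open>i\<close> of the element to be classified, whether
  this element is compared with \<open>p\<close> first (\<open>True\<close>) or with \<open>q\<close> first (\<open>False\<close>).
\<close>

type_synonym strategy = "nat list \<Rightarrow> nat \<Rightarrow> bool"

definition clairvoyant :: strategy where
  "clairvoyant xs i \<longleftrightarrow>
     int (small_total xs) - int (small_seen xs (i - 1))
       \<ge> int (large_total xs) - int (large_seen xs (i - 1))"

definition count_strategy :: strategy where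
  "count_strategy xs i \<longleftrightarrow> small_seen xs (i - 1) \<ge> large_seen xs (i - 1)"

text \<open>
  The first comparison settles the class exactly if it finds \<open>x < p\<close> or \<open>x > q\<close>, respectively.
\<close>

definition classification_cost :: "nat \<Rightarrow> nat \<Rightarrow> bool \<Rightarrow> nat \<Rightarrow> nat" where
  "classification_cost p q p_first x =
     (if p_first then (if x < p then 1 else 2) else (if x > q then 1 else 2))"

text \<open>The summand 1 is the comparison of \<open>a\<^sub>1\<close> with \<open>a\<^sub>n\<close>.\<close>

definition partition_comparisons :: "strategy \<Rightarrow> nat list \<Rightarrow> nat" where
  "partition_comparisons strat xs =
     1 + (\<Sum>i = 1..length xs - 2.
            classification_cost (pivot_p xs) (pivot_q xs) (strat xs i) (xs ! i))"

definition random_input :: "nat \<Rightarrow> nat list pmf" where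
  "random_input n = pmf_of_set (permutations_of_set {1..n})"

definition P_cv :: "nat \<Rightarrow> nat pmf" where
  "P_cv n = map_pmf (partition_comparisons clairvoyant) (random_input n)"

definition P_ct :: "nat \<Rightarrow> nat pmf" where
  "P_ct n = map_pmf (partition_comparisons count_strategy) (random_input n)"


section \<open>Random lattice paths\<close>

text \<open>
  A path of length \<open>m\<close> is the list \<open>w\<close> of its \<open>m + 1\<close> heights, i.e. it consists of the points
  \<open>(x, w ! x)\<close> for \<open>0 \<le> x \<le> m\<close>.
\<close>

definition lattice_paths :: "nat \<Rightarrow> int \<Rightarrow> int list set" where
  "lattice_paths m S =
     {w. length w = m + 1 \<and> w ! 0 = S \<and> w ! m = 0 \<and>
         (\<forall>x<m. w ! (x + 1) = w ! x + 1 \<or> w ! (x + 1) = w ! x - 1)}"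

definition start_heights :: "nat \<Rightarrow> int set" where
  "start_heights m = (\<lambda>k. 2 * int k - int m) ` {0..m}"

definition random_path :: "nat \<Rightarrow> int list pmf" where
  "random_path m = do {
     S \<leftarrow> pmf_of_set (start_heights m);
     pmf_of_set (lattice_paths m S)
   }"

definition random_pivot_path :: "nat \<Rightarrow> int list pmf" where
  "random_pivot_path n = do {
     (P, Q) \<leftarrow> pmf_of_set {(P, Q). 1 \<le> P \<and> P < Q \<and> Q \<le> n};
     random_path (n - 1 - (Q - P))
   }"

definition up_to_zero :: "int list \<Rightarrow> nat" where
  "up_to_zero w = card {x. 1 \<le> x \<and> x < length w \<and> w ! x = 0 \<and> w ! (x - 1) = -1}"

definition down_from_zero :: "int list \<Rightarrow> nat" where
  "down_from_zero w = card {x. x + 1 < length w \<and> w ! x = 0 \<and> w ! (x + 1) = -1}"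

definition X_up :: "nat \<Rightarrow> nat pmf" where
  "X_up n = map_pmf up_to_zero (random_pivot_path n)"

definition X_down :: "nat \<Rightarrow> nat pmf" where
  "X_down n = map_pmf down_from_zero (random_pivot_path n)"

definition expected :: "nat pmf \<Rightarrow> real" where
  "expected X = measure_pmf.expectation X real"

end

theory Submission
  imports Defs
begin

text \<open>
  Deleting the medium elements from the input leaves a word of small and large elements that, given
  the pivots, is uniformly random; it is a lattice path from height \<open>s - \<ell>\<close> to \<open>0\<close>, whose
  height is the number of small minus the number of large elements still to come. Small steps go
  down and large steps go up. Besides \<open>n - 1\<close> comparisons and one more for every medium element,
  Clairvoyant pays for the up-steps starting at height \<open>\<ge> 0\<close> and for the down-steps starting at
  height \<open>< 0\<close>. Balancing the up- and down-steps on either side of the axis gives \<open>min s \<ell>\<close>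
  such steps, minus the number of down-from-zero situations, since the steps from \<open>0\<close> to \<open>-1\<close>
  are the only down-steps starting at height \<open>\<ge> 0\<close> that end below the axis. Count behaves
  like this on the reversed word, where the steps between \<open>0\<close> and \<open>-1\<close> are added instead.
\<close>

lemma down_from_zero_Cons:
  assumes "w \<noteq> []"
  shows "down_from_zero (h # w) = of_bool (h = 0 \<and> hd w = -1) + down_from_zero w"
proof -
  let ?A = "{x. x + 1 < length w \<and> w ! x = 0 \<and> w ! (x + 1) = -1}"
  let ?Z = "if h = 0 \<and> hd w = -1 then {0 :: nat} else {}"
  have "{x. x + 1 < length (h # w) \<and> (h # w) ! x = 0 \<and> (h # w) ! (x + 1) = -1} = ?Z \<union> Suc ` ?A"
    (is "?L = ?R")
  proof (rule set_eqI)
    fix x show "x \<in> ?L \<longleftrightarrow> x \<in> ?R"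
      using assms by (cases x) (auto simp: hd_conv_nth)
  qed
  moreover have "finite ?A"
    by (rule finite_subset[of _ "{..length w}"]) auto
  ultimately show ?thesis
    by (simp add: down_from_zero_def card_Un_disjoint card_image)
qed

lemma up_to_zero_Cons:
  assumes "w \<noteq> []"
  shows "up_to_zero (h # w) = of_bool (h = -1 \<and> hd w = 0) + up_to_zero w"
proof -
  let ?A = "{x. 1 \<le> x \<and> x < length w \<and> w ! x = 0 \<and> w ! (x - 1) = -1}"
  let ?Z = "if h = -1 \<and> hd w = 0 then {1 :: nat} else {}"
  have "{x. 1 \<le> x \<and> x < length (h # w) \<and> (h # w) ! x = 0 \<and> (h # w) ! (x - 1) = -1} = ?Z \<union> Suc ` ?A"
    (is "?L = ?R")
  proof (rule set_eqI)
    fix x show "x \<in> ?L \<longleftrightarrow> x \<in> ?R"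
    proof (cases "x \<le> 1")
      case True
      then have "x = 0 \<or> x = 1" by auto
      then show ?thesis using assms by (auto simp: hd_conv_nth)
    next
      case False
      then obtain y where "x = Suc (Suc y)" by (metis One_nat_def not_less_eq_eq old.nat.exhaust le0)
      then show ?thesis by auto
    qed
  qed
  moreover have "finite ?A"
    by (rule finite_subset[of _ "{..length w}"]) auto
  moreover have "?Z \<inter> Suc ` ?A = {}" by auto
  ultimately show ?thesis
    by (simp add: up_to_zero_def card_Un_disjoint card_image)
qed

text \<open>
  A word records the small (\<open>True\<close>) and large (\<open>False\<close>) elements in their order of appearance; the
  height at \<open>x\<close> is the number of small minus the number of large elements still to come.
\<close>

fun heights :: "bool list \<Rightarrow> int list" where
  "heights [] = [0]"
| "heights (b # w) = (hd (heights w) + (if b then 1 else -1)) # heights w"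

lemma heights_nonempty [simp]: "heights w \<noteq> []"
  by (cases w) auto

lemma length_heights [simp]: "length (heights w) = length w + 1"
  by (induction w) auto

lemma hd_heights: "hd (heights w) = int (count (mset w) True) - int (count (mset w) False)"
  by (induction w) auto

lemma inj_heights: "inj heights"
proof (rule injI)
  fix u v assume "heights u = heights v"
  then show "u = v"
  proof (induction u arbitrary: v)
    case Nil
    then have "length (heights []) = length (heights v)" by simp
    then show ?case by simp
  next
    case (Cons b u)
    then show ?case by (cases v) (auto split: if_splits)
  qed
qed

lemma heights_in_lattice_paths: "heights w \<in> lattice_paths (length w) (hd (heights w))"
proof (induction w)
  case (Cons b w)
  have "heights (b # w) ! (x + 1) = heights (b # w) ! x + 1 \<or>
        heights (b # w) ! (x + 1) = heights (b # w) ! x - 1" if "x < length (b # w)" for x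
    using Cons that by (cases x) (auto simp: lattice_paths_def hd_conv_nth)
  with Cons show ?case
    by (auto simp: lattice_paths_def)
qed (simp add: lattice_paths_def)

lemma lattice_paths_heights: "w \<in> lattice_paths m S \<Longrightarrow> \<exists>u. length u = m \<and> heights u = w"
proof (induction m arbitrary: w S)
  case 0
  then show ?case by (auto simp: lattice_paths_def length_Suc_conv)
next
  case (Suc m)
  then obtain h r where w: "w = h # r"
    by (cases w) (auto simp: lattice_paths_def)
  have r: "length r = m + 1" "r ! m = 0" "r \<noteq> []"
    and step: "x < Suc m \<Longrightarrow> r ! x = (h # r) ! x + 1 \<or> r ! x = (h # r) ! x - 1" for x
    using Suc.prems unfolding w lattice_paths_def by auto
  have "r ! (x + 1) = r ! x + 1 \<or> r ! (x + 1) = r ! x - 1" if "x < m" for x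
    using step[of "x + 1"] that by simp
  with r have "r \<in> lattice_paths m (hd r)"
    by (simp add: lattice_paths_def hd_conv_nth)
  then obtain u where u: "length u = m" "heights u = r"
    using Suc.IH by blast
  have "hd r = h + 1 \<or> hd r = h - 1"
    using step[of 0] r by (simp add: hd_conv_nth)
  then have "heights ((hd r = h - 1) # u) = w"
    using u by (auto simp: w)
  with u show ?case
    by (intro exI[of _ "(hd r = h - 1) # u"]) auto
qed

abbreviation words :: "nat \<Rightarrow> nat \<Rightarrow> bool list set" where
  "words s l \<equiv> permutations_of_multiset (replicate_mset s True + replicate_mset l False)"

lemma bij_betw_heights:
  "bij_betw heights (words s l) (lattice_paths (s + l) (int s - int l))"
proof (rule bij_betw_imageI)
  show "inj_on heights (words s l)"
    using inj_heights by (rule inj_on_subset) simp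
  show "heights ` words s l = lattice_paths (s + l) (int s - int l)"
  proof (intro equalityI subsetI)
    fix w assume "w \<in> heights ` words s l"
    then obtain u where u: "w = heights u" "mset u = replicate_mset s True + replicate_mset l False"
      by (auto simp: permutations_of_multiset_def)
    then have "length u = s + l" by (metis size_mset size_replicate_mset size_union)
    then show "w \<in> lattice_paths (s + l) (int s - int l)"
      using heights_in_lattice_paths[of u] u by (simp add: hd_heights)
  next
    fix w assume w: "w \<in> lattice_paths (s + l) (int s - int l)"
    then obtain u where u: "length u = s + l" "heights u = w"
      using lattice_paths_heights by blast
    have "hd w = int s - int l"
      using w by (auto simp: lattice_paths_def hd_conv_nth simp flip: length_greater_0_conv)
    then have "int (count (mset u) True) - int (count (mset u) False) = int s - int l"
      using u hd_heights[of u] by simp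
    moreover have "count (mset u) True + count (mset u) False = length u"
      by (induction u) auto
    ultimately have "count (mset u) True = s" "count (mset u) False = l"
      using u by linarith+
    then have "mset u = replicate_mset s True + replicate_mset l False"
      by (intro multiset_eqI) (metis (full_types) add.right_neutral add_0 count_replicate_mset count_union)
    with u show "w \<in> heights ` words s l"
      by (auto simp: permutations_of_multiset_def)
  qed
qed

definition class_word :: "nat \<Rightarrow> nat \<Rightarrow> nat list \<Rightarrow> bool list" where
  "class_word p q ys = map (\<lambda>y. y < p) (filter (\<lambda>y. y < p \<or> q < y) ys)"

lemma count_class_word:
  assumes "p < q"
  shows "count (mset (class_word p q ys)) True = length (filter (\<lambda>y. y < p) ys)"
    and "count (mset (class_word p q ys)) False = length (filter (\<lambda>y. q < y) ys)"
  using assms by (induction ys) (auto simp: class_word_def)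

lemma suffix_cost:
  assumes "p < q"
  shows "(\<Sum>j<length ys. classification_cost p q
            (length (filter (\<lambda>y. q < y) (drop j ys)) \<le> length (filter (\<lambda>y. y < p) (drop j ys))) (ys ! j))
          + down_from_zero (heights (class_word p q ys))
        = length ys + length (filter (\<lambda>y. p \<le> y \<and> y \<le> q) ys)
          + min (length (filter (\<lambda>y. y < p) ys)) (length (filter (\<lambda>y. q < y) ys))"
proof (induction ys)
  case Nil
  then show ?case by (simp add: class_word_def down_from_zero_def)
next
  case (Cons y ys)
  have w: "class_word p q (y # ys) =
             (if y < p \<or> q < y then (y < p) # class_word p q ys else class_word p q ys)"
    by (simp add: class_word_def)
  have s: "(\<Sum>j<length (y # ys). classification_cost p q
            (length (filter (\<lambda>y. q < y) (drop j (y # ys))) \<le> length (filter (\<lambda>y. y < p) (drop j (y # ys)))) ((y # ys) ! j))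
     = classification_cost p q
         (length (filter (\<lambda>y. q < y) (y # ys)) \<le> length (filter (\<lambda>y. y < p) (y # ys))) y
       + (\<Sum>j<length ys. classification_cost p q
            (length (filter (\<lambda>y. q < y) (drop j ys)) \<le> length (filter (\<lambda>y. y < p) (drop j ys))) (ys ! j))"
    by (simp add: sum.lessThan_Suc_shift del: sum.lessThan_Suc)
  let ?S = "\<Sum>j<length ys. classification_cost p q
            (length (filter (\<lambda>y. q < y) (drop j ys)) \<le> length (filter (\<lambda>y. y < p) (drop j ys))) (ys ! j)"
  define T where "T = ?S"
  consider "y < p" | "q < y" | "p \<le> y" "y \<le> q" by linarith
  then show ?case
    using Cons assms unfolding w s T_def[symmetric]
    by cases (auto simp: down_from_zero_Cons hd_heights count_class_word classification_cost_def min_def)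
qed

lemma prefix_cost:
  assumes "p < q"
  shows "(\<Sum>j<length ys. classification_cost p q
            (length (filter (\<lambda>y. q < y) (take j ys)) \<le> length (filter (\<lambda>y. y < p) (take j ys))) (ys ! j))
        = length ys + length (filter (\<lambda>y. p \<le> y \<and> y \<le> q) ys)
          + min (length (filter (\<lambda>y. y < p) ys)) (length (filter (\<lambda>y. q < y) ys))
          + up_to_zero (heights (rev (class_word p q ys)))"
proof (induction ys rule: rev_induct)
  case Nil
  then show ?case by (simp add: class_word_def up_to_zero_def)
next
  case (snoc y ys)
  have w: "rev (class_word p q (ys @ [y])) =
             (if y < p \<or> q < y then (y < p) # rev (class_word p q ys) else rev (class_word p q ys))"
    by (simp add: class_word_def)
  let ?S = "\<Sum>j<length ys. classification_cost p q
            (length (filter (\<lambda>y. q < y) (take j ys)) \<le> length (filter (\<lambda>y. y < p) (take j ys))) (ys ! j)"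
  have s: "(\<Sum>j<length (ys @ [y]). classification_cost p q
            (length (filter (\<lambda>y. q < y) (take j (ys @ [y]))) \<le> length (filter (\<lambda>y. y < p) (take j (ys @ [y])))) ((ys @ [y]) ! j))
     = ?S + classification_cost p q
         (length (filter (\<lambda>y. q < y) ys) \<le> length (filter (\<lambda>y. y < p) ys)) y"
    by (simp add: nth_append)
  define T where "T = ?S"
  consider "y < p" | "q < y" | "p \<le> y" "y \<le> q" by linarith
  then show ?case
    using snoc assms unfolding w s T_def[symmetric]
    by cases (auto simp: up_to_zero_Cons hd_heights count_class_word classification_cost_def min_def)
qed

lemma map_pmf_of_permutations:
  assumes "finite A"
  shows "map_pmf (map f) (pmf_of_set (permutations_of_set A)) =
         pmf_of_set (permutations_of_multiset (image_mset f (mset_set A)))"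
    (is "?L = pmf_of_set ?W")
proof -
  let ?U = "pmf_of_set (permutations_of_set A)"
  \<comment> \<open>Permuting positions preserves the law of the image and acts transitively on \<open>?W\<close>.\<close>
  have le: "pmf ?L v \<le> pmf ?L u" if u: "u \<in> ?W" and v: "v \<in> ?W" for u v
  proof -
    have len: "length v = card A"
      using v by (metis permutations_of_multisetD size_image_mset size_mset size_mset_set)
    obtain \<sigma> where \<sigma>: "\<sigma> permutes {..<length v}" "permute_list \<sigma> v = u"
      using u v by (metis mset_eq_permutation permutations_of_multisetD)
    let ?g = "permute_list \<sigma>"
    have "inj_on ?g (permutations_of_set A)"
    proof (rule inj_on_inverseI)
      fix xs assume "xs \<in> permutations_of_set A"
      then have "\<sigma> permutes {..<length xs}"
        using \<sigma> len by (simp add: length_finite_permutations_of_set)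
      then show "permute_list (inv \<sigma>) (?g xs) = xs"
        by (metis permute_list_compose permute_list_id permutes_inv permutes_inv_o(1))
    qed
    moreover have "?g ` permutations_of_set A \<subseteq> permutations_of_set A"
      using \<sigma> len by (auto simp: permutations_of_set_def distinct_card)
    ultimately have "bij_betw ?g (permutations_of_set A) (permutations_of_set A)"
      by (simp add: bij_betw_def endo_inj_surj)
    then have U: "map_pmf ?g ?U = ?U"
      using assms by (intro map_pmf_of_set_bij_betw) auto
    have "map_pmf (map f) (map_pmf ?g ?U) = map_pmf ?g (map_pmf (map f) ?U)"
      unfolding pmf.map_comp using \<sigma> len assms
      by (intro map_pmf_cong) (auto simp: length_finite_permutations_of_set permute_list_map)
    then have L: "?L = map_pmf ?g ?L"
      unfolding U .
    have "pmf ?L v = measure ?L {v}"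
      by (simp add: pmf.rep_eq)
    also have "\<dots> \<le> measure ?L (?g -` {u})"
      using \<sigma> by (intro measure_pmf.finite_measure_mono) auto
    also have "\<dots> = pmf (map_pmf ?g ?L) u"
      by (simp only: pmf_map)
    finally show ?thesis using L by simp
  qed
  have set: "set_pmf ?L = ?W"
    using assms by (simp add: permutations_of_multiset_image permutations_of_set_altdef)
  have ne: "?W \<noteq> {}" unfolding set[symmetric] by (rule set_pmf_not_empty)
  show ?thesis
  proof (rule pmf_eqI)
    fix u
    show "pmf ?L u = pmf (pmf_of_set ?W) u"
    proof (cases "u \<in> ?W")
      case True
      have "(\<Sum>v\<in>?W. pmf ?L v) = 1"
        using set by (intro sum_pmf_eq_1) auto
      also have "(\<Sum>v\<in>?W. pmf ?L v) = (\<Sum>v\<in>?W. pmf ?L u)"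
        using le True by (intro sum.cong antisym) auto
      finally show ?thesis
        using True ne by (simp add: field_simps)
    next
      case False
      then have "pmf ?L u = 0"
        unfolding set[symmetric] by (simp only: set_pmf_iff not_not)
      with False ne show ?thesis by simp
    qed
  qed
qed

lemma map_pmf_class_word:
  assumes "finite A" "p < q"
  shows "map_pmf (class_word p q) (pmf_of_set (permutations_of_set A)) =
         pmf_of_set (words (card {y \<in> A. y < p}) (card {y \<in> A. q < y}))"
proof -
  let ?P = "\<lambda>y. y < p \<or> q < y"
  have "map_pmf (filter ?P) (pmf_of_set (permutations_of_set A)) =
        map_pmf fst (map_pmf (partition ?P) (pmf_of_set (permutations_of_set A)))"
    by (simp add: pmf.map_comp o_def)
  also have "\<dots> = pmf_of_set (permutations_of_set {y \<in> A. ?P y})"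
    using assms by (simp only: partition_random_permutations map_fst_pair_pmf)
  finally have "map_pmf (class_word p q) (pmf_of_set (permutations_of_set A)) =
      map_pmf (map (\<lambda>y. y < p)) (pmf_of_set (permutations_of_set {y \<in> A. ?P y}))"
    by (simp add: class_word_def[abs_def] pmf.map_comp o_def flip: \<open>_ = pmf_of_set (permutations_of_set {y \<in> A. ?P y})\<close>)
  also have "{y \<in> A. ?P y} = {y \<in> A. y < p} \<union> {y \<in> A. q < y}"
    by auto
  also have "map_pmf (map (\<lambda>y. y < p)) (pmf_of_set (permutations_of_set \<dots>)) =
      pmf_of_set (permutations_of_multiset (image_mset (\<lambda>y. y < p) (mset_set ({y \<in> A. y < p} \<union> {y \<in> A. q < y}))))"
    using assms by (intro map_pmf_of_permutations) auto
  also have "mset_set ({y \<in> A. y < p} \<union> {y \<in> A. q < y}) = mset_set {y \<in> A. y < p} + mset_set {y \<in> A. q < y}"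
    using assms by (intro mset_set_Union) auto
  also have "image_mset (\<lambda>y. y < p) \<dots> = image_mset (\<lambda>_. True) (mset_set {y \<in> A. y < p}) + image_mset (\<lambda>_. False) (mset_set {y \<in> A. q < y})"
    using assms unfolding image_mset_union by (intro arg_cong2[where f = "(+)"] image_mset_cong) auto
  finally show ?thesis by (simp add: image_mset_const_eq)
qed

lemma map_pmf_heights_class_word:
  assumes "finite A" "p < q"
  defines "s \<equiv> card {y \<in> A. y < p}" and "l \<equiv> card {y \<in> A. q < y}"
  shows "map_pmf (\<lambda>ys. heights (class_word p q ys)) (pmf_of_set (permutations_of_set A)) =
         pmf_of_set (lattice_paths (s + l) (int s - int l))" (is ?th1)
    and "map_pmf (\<lambda>ys. heights (rev (class_word p q ys))) (pmf_of_set (permutations_of_set A)) =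
         pmf_of_set (lattice_paths (s + l) (int s - int l))" (is ?th2)
proof -
  note cw = map_pmf_class_word[OF assms(1,2), folded s_def l_def]
  have h: "map_pmf heights (pmf_of_set (words s l)) = pmf_of_set (lattice_paths (s + l) (int s - int l))"
    by (intro map_pmf_of_set_bij_betw bij_betw_heights) auto
  have r: "map_pmf rev (pmf_of_set (words s l)) = pmf_of_set (words s l)"
    by (intro map_pmf_of_set_bij_betw) (auto simp: bij_betw_def inj_on_def)
  have "map_pmf (\<lambda>ys. heights (class_word p q ys)) (pmf_of_set (permutations_of_set A)) =
        map_pmf heights (map_pmf (class_word p q) (pmf_of_set (permutations_of_set A)))"
    by (simp add: pmf.map_comp o_def)
  then show ?th1 unfolding cw h .
  have "map_pmf (\<lambda>ys. heights (rev (class_word p q ys))) (pmf_of_set (permutations_of_set A)) =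
        map_pmf heights (map_pmf rev (map_pmf (class_word p q) (pmf_of_set (permutations_of_set A))))"
    by (simp add: pmf.map_comp o_def)
  then show ?th2 unfolding cw r h .
qed

abbreviation pivot_pairs :: "nat \<Rightarrow> (nat \<times> nat) set" where
  "pivot_pairs n \<equiv> {(P, Q). 1 \<le> P \<and> P < Q \<and> Q \<le> n}"

lemma finite_pivot_pairs: "finite (pivot_pairs n)"
  by (rule finite_subset[of _ "{..n} \<times> {..n}"]) auto

lemma sum_pivot_pairs:
  fixes h :: "nat \<Rightarrow> nat \<Rightarrow> 'a :: comm_monoid_add"
  shows "(\<Sum>(p, q)\<in>pivot_pairs n. h p q) = (\<Sum>m<n - 1. \<Sum>k\<le>m. h (k + 1) (n + k - m))"
proof -
  have "(\<Sum>(p, q)\<in>pivot_pairs n. h p q) = (\<Sum>(m, k)\<in>Sigma {..<n - 1} (\<lambda>m. {..m}). h (k + 1) (n + k - m))"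
    by (rule sum.reindex_bij_witness[of _ "\<lambda>(m, k). (k + 1, n + k - m)"
          "\<lambda>(p, q). (n - 1 - (q - p), p - 1)"]) auto
  then show ?thesis by (simp add: sum.Sigma)
qed

lemma card_pivot_pairs: "real (card (pivot_pairs n)) = real n * (real n - 1) / 2"
proof -
  have "card (pivot_pairs n) = (\<Sum>(p, q)\<in>pivot_pairs n. 1)"
    by (simp add: case_prod_unfold)
  also have "\<dots> = (\<Sum>m<n - 1. m + 1)"
    by (subst sum_pivot_pairs) simp
  finally have c: "card (pivot_pairs n) = (\<Sum>m<n - 1. m + 1)" .
  have "real (\<Sum>m<k. m + 1) = real (k + 1) * real k / 2" for k
    by (induction k) (auto simp: field_simps)
  from this[of "n - 1"] show ?thesis
    unfolding c by (cases n) auto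
qed

lemma lattice_paths_finite_nonempty:
  assumes "k \<le> m"
  shows "finite (lattice_paths m (2 * int k - int m))" "lattice_paths m (2 * int k - int m) \<noteq> {}"
proof -
  have "lattice_paths m (2 * int k - int m) = heights ` words k (m - k)"
    using bij_betw_heights[of k "m - k"] assms by (simp add: bij_betw_def of_nat_diff)
  then show "finite (lattice_paths m (2 * int k - int m))" "lattice_paths m (2 * int k - int m) \<noteq> {}"
    by simp_all
qed

lemma finite_set_random_path: "finite (set_pmf (random_path m))"
proof -
  have "set_pmf (random_path m) = (\<Union>S\<in>start_heights m. set_pmf (pmf_of_set (lattice_paths m S)))"
    unfolding random_path_def set_bind_pmf
    by (subst set_pmf_of_set) (auto simp: start_heights_def)
  then show ?thesis
    by (auto simp: start_heights_def lattice_paths_finite_nonempty)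
qed

lemma expectation_random_path:
  fixes f :: "int list \<Rightarrow> real"
  shows "measure_pmf.expectation (random_path m) f =
    (\<Sum>k\<le>m. measure_pmf.expectation (pmf_of_set (lattice_paths m (2 * int k - int m))) f) / real (Suc m)"
proof -
  have inj: "inj_on (\<lambda>k. 2 * int k - int m) {0..m}"
    by (auto simp: inj_on_def)
  have c: "card (start_heights m) = m + 1"
    unfolding start_heights_def by (simp add: card_image[OF inj])
  have "measure_pmf.expectation (random_path m) f =
    (\<Sum>S\<in>start_heights m. measure_pmf.expectation (pmf_of_set (lattice_paths m S)) f /\<^sub>R real (card (start_heights m)))"
    unfolding random_path_def
    using lattice_paths_finite_nonempty
    by (intro pmf_expectation_bind_pmf_of_set) (auto simp: start_heights_def)
  also have "\<dots> = (\<Sum>S\<in>start_heights m. measure_pmf.expectation (pmf_of_set (lattice_paths m S)) f) / real (Suc m)"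
    unfolding c by (simp add: sum_distrib_left divide_inverse mult.commute add.commute)
  finally show ?thesis
    unfolding start_heights_def sum.reindex[OF inj] by (simp add: o_def atMost_atLeast0)
qed

text \<open>Given \<open>Q - P\<close>, the difference of the numbers of small and large elements is uniform.\<close>

lemma expectation_random_pivot_path:
  fixes f :: "int list \<Rightarrow> real"
  assumes "n \<ge> 2"
  shows "measure_pmf.expectation (random_pivot_path n) f =
    (\<Sum>(p, q)\<in>pivot_pairs n. measure_pmf.expectation
       (pmf_of_set (lattice_paths (n - 1 - (q - p)) (int (p - 1) - int (n - q)))) f) / card (pivot_pairs n)"
proof -
  let ?\<phi> = "\<lambda>m k. measure_pmf.expectation (pmf_of_set (lattice_paths m (2 * int k - int m))) f"
  have "(1, 2) \<in> pivot_pairs n"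
    using assms by simp
  then have "pivot_pairs n \<noteq> {}"
    by blast
  then have "measure_pmf.expectation (random_pivot_path n) f = (\<Sum>pq\<in>pivot_pairs n.
      measure_pmf.expectation (case pq of (p, q) \<Rightarrow> random_path (n - 1 - (q - p))) f /\<^sub>R card (pivot_pairs n))"
    unfolding random_pivot_path_def
    by (intro pmf_expectation_bind_pmf_of_set finite_pivot_pairs)
      (simp_all only: case_prod_unfold finite_set_random_path not_False_eq_True)
  also have "\<dots> = (\<Sum>(p, q)\<in>pivot_pairs n. measure_pmf.expectation (random_path (n - 1 - (q - p))) f)
      / card (pivot_pairs n)"
    by (simp add: sum_distrib_left divide_inverse mult.commute case_prod_unfold)
  also have "(\<Sum>(p, q)\<in>pivot_pairs n. measure_pmf.expectation (random_path (n - 1 - (q - p))) f) =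
      (\<Sum>m<n - 1. \<Sum>k\<le>m. measure_pmf.expectation (random_path m) f)"
    by (subst sum_pivot_pairs) (auto intro!: sum.cong)
  also have "\<dots> = (\<Sum>m<n - 1. \<Sum>k\<le>m. ?\<phi> m k)"
    by (rule sum.cong) (simp_all add: expectation_random_path)
  also have "\<dots> = (\<Sum>(p, q)\<in>pivot_pairs n. measure_pmf.expectation
       (pmf_of_set (lattice_paths (n - 1 - (q - p)) (int (p - 1) - int (n - q)))) f)"
  proof (subst sum_pivot_pairs, intro sum.cong refl)
    fix m k assume "m \<in> {..<n - 1}" "k \<in> {..m}"
    then have "k \<le> m" "m + 2 \<le> n"
      by auto
    then obtain i j where "m = k + i" "n = m + 2 + j"
      unfolding le_iff_add by blast
    then have "n - 1 - (n + k - m - (k + 1)) = m" "int (k + 1 - 1) - int (n - (n + k - m)) = 2 * int k - int m"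
      by simp_all
    then show "?\<phi> m k = measure_pmf.expectation (pmf_of_set (lattice_paths (n - 1 - (n + k - m - (k + 1)))
        (int (k + 1 - 1) - int (n - (n + k - m))))) f"
      by simp
  qed
  finally show ?thesis .
qed

lemma sum_permutations_split_ends:
  fixes F :: "'a list \<Rightarrow> 'b :: comm_monoid_add"
  assumes "finite A" "card A \<ge> 2"
  shows "(\<Sum>xs\<in>permutations_of_set A. F xs) =
    (\<Sum>(a, b)\<in>{(a, b). a \<in> A \<and> b \<in> A \<and> a \<noteq> b}. \<Sum>ys\<in>permutations_of_set (A - {a, b}). F (a # ys @ [b]))"
proof -
  let ?D = "{(a, b). a \<in> A \<and> b \<in> A \<and> a \<noteq> b}"
  have D: "finite ?D"
    by (rule finite_subset[of _ "A \<times> A"]) (use assms in auto)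
  have ends: "hd xs # butlast (tl xs) @ [last xs] = xs" "hd xs \<noteq> last xs"
    if "xs \<in> permutations_of_set A" for xs
  proof -
    have "length xs \<ge> 2"
      using that assms by (simp add: length_finite_permutations_of_set)
    then have "xs \<noteq> []" "tl xs \<noteq> []" by (auto simp flip: length_greater_0_conv)
    then show *: "hd xs # butlast (tl xs) @ [last xs] = xs"
      by (metis append_butlast_last_id last_tl list.collapse)
    then show "hd xs \<noteq> last xs"
      using permutations_of_setD(2)[OF that] by (metis distinct.simps(2) in_set_conv_decomp)
  qed
  have "(\<Sum>xs\<in>permutations_of_set A. F xs) =
      (\<Sum>(ab, ys)\<in>Sigma ?D (\<lambda>ab. permutations_of_set (A - {fst ab, snd ab})). F (fst ab # ys @ [snd ab]))"
  proof (rule sum.reindex_bij_witness[of _ "\<lambda>(ab, ys). fst ab # ys @ [snd ab]"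
        "\<lambda>xs. ((hd xs, last xs), butlast (tl xs))"], goal_cases)
    case (1 xs)
    then show ?case using ends(1)[OF 1] by simp
  next
    case (2 xs)
    let ?a = "hd xs" and ?b = "last xs" and ?ys = "butlast (tl xs)"
    have xs: "set (?a # ?ys @ [?b]) = A" "distinct (?a # ?ys @ [?b])"
      using ends(1)[OF 2] permutations_of_setD[OF 2] by metis+
    then show ?case
      by (auto simp: permutations_of_set_def)
  next
    case (3 x)
    then show ?case by (cases x) simp
  next
    case (4 x)
    obtain a b ys where x: "x = ((a, b), ys)" by (metis prod.exhaust)
    have ab: "a \<in> A" "b \<in> A" "a \<noteq> b" and ys: "set ys = A - {a, b}" "distinct ys"
      using 4 by (simp_all add: x permutations_of_set_def)
    then have "set (a # ys @ [b]) = A" by auto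
    with ab ys show ?case by (simp add: x permutations_of_set_def)
  next
    case (5 xs)
    then show ?case using ends(1)[OF 5] by simp
  qed
  also have "\<dots> = (\<Sum>ab\<in>?D. \<Sum>ys\<in>permutations_of_set (A - {fst ab, snd ab}). F (fst ab # ys @ [snd ab]))"
    by (rule sum.Sigma[OF D, symmetric]) simp
  finally show ?thesis by (simp add: case_prod_unfold)
qed

lemma expected_random_input:
  assumes "n \<ge> 2"
    and F: "\<And>a b ys. a \<in> {1..n} \<Longrightarrow> b \<in> {1..n} \<Longrightarrow> a \<noteq> b \<Longrightarrow> ys \<in> permutations_of_set ({1..n} - {a, b}) \<Longrightarrow>
        real (F (a # ys @ [b])) = G (min a b) (max a b) ys"
  shows "expected (map_pmf F (random_input n)) =
    (\<Sum>(p, q)\<in>pivot_pairs n. measure_pmf.expectation (pmf_of_set (permutations_of_set ({1..n} - {p, q}))) (G p q))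
      / card (pivot_pairs n)"
proof -
  let ?D = "{(a, b). a \<in> {1..n} \<and> b \<in> {1..n} \<and> a \<noteq> b}"
  let ?H = "\<lambda>p q. \<Sum>ys\<in>permutations_of_set ({1..n} - {p, q}). G p q ys"
  have "(\<Sum>xs\<in>permutations_of_set {1..n}. real (F xs)) =
      (\<Sum>(a, b)\<in>?D. \<Sum>ys\<in>permutations_of_set ({1..n} - {a, b}). real (F (a # ys @ [b])))"
    using assms(1) by (intro sum_permutations_split_ends) auto
  also have "\<dots> = (\<Sum>(a, b)\<in>?D. ?H (min a b) (max a b))"
  proof (intro sum.cong refl, clarify)
    fix a b assume ab: "a \<in> {1..n}" "b \<in> {1..n}" "a \<noteq> b"
    have "{min a b, max a b} = {a, b}" by (auto simp: min_def max_def)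
    then show "(\<Sum>ys\<in>permutations_of_set ({1..n} - {a, b}). real (F (a # ys @ [b]))) = ?H (min a b) (max a b)"
      using F ab by (intro sum.cong) auto
  qed
  also have "?D = pivot_pairs n \<union> prod.swap ` pivot_pairs n"
    by (force simp: image_iff)
  also have "(\<Sum>(a, b)\<in>\<dots>. ?H (min a b) (max a b)) =
      (\<Sum>(a, b)\<in>pivot_pairs n. ?H (min a b) (max a b)) + (\<Sum>(a, b)\<in>prod.swap ` pivot_pairs n. ?H (min a b) (max a b))"
    using finite_pivot_pairs by (intro sum.union_disjoint) auto
  also have "(\<Sum>(a, b)\<in>prod.swap ` pivot_pairs n. ?H (min a b) (max a b)) =
      (\<Sum>(a, b)\<in>pivot_pairs n. ?H (min a b) (max a b))"
    by (subst sum.reindex) (auto intro!: inj_onI sum.cong simp: min.commute max.commute)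
  also have "(\<Sum>(a, b)\<in>pivot_pairs n. ?H (min a b) (max a b)) = (\<Sum>(a, b)\<in>pivot_pairs n. ?H a b)"
    by (intro sum.cong) auto
  finally have S: "(\<Sum>xs\<in>permutations_of_set {1..n}. real (F xs)) = 2 * (\<Sum>(p, q)\<in>pivot_pairs n. ?H p q)"
    by simp
  have E: "measure_pmf.expectation (pmf_of_set (permutations_of_set ({1..n} - {p, q}))) (G p q) = ?H p q / fact (n - 2)"
    if "(p, q) \<in> pivot_pairs n" for p q
  proof -
    have "card ({1..n} - {p, q}) = n - 2"
      using that by (subst card_Diff_subset) auto
    then show ?thesis by (subst integral_pmf_of_set) auto
  qed
  have "expected (map_pmf F (random_input n)) = (\<Sum>xs\<in>permutations_of_set {1..n}. real (F xs)) / fact n"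
    by (simp add: expected_def random_input_def integral_pmf_of_set)
  also have "(fact n :: real) = real n * (real n - 1) * fact (n - 2)"
  proof -
    obtain k where "n = Suc (Suc k)"
      using assms(1) by (metis add_2_eq_Suc le_Suc_ex)
    then show ?thesis by (simp add: algebra_simps)
  qed
  also have "(\<Sum>xs\<in>permutations_of_set {1..n}. real (F xs)) / (real n * (real n - 1) * fact (n - 2)) =
      (\<Sum>(p, q)\<in>pivot_pairs n. ?H p q / fact (n - 2)) / card (pivot_pairs n)"
    unfolding S card_pivot_pairs by (simp add: case_prod_unfold mult_ac flip: sum_divide_distrib)
  also have "(\<Sum>(p, q)\<in>pivot_pairs n. ?H p q / fact (n - 2)) = (\<Sum>(p, q)\<in>pivot_pairs n.
      measure_pmf.expectation (pmf_of_set (permutations_of_set ({1..n} - {p, q}))) (G p q))"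
    using E by (intro sum.cong) auto
  finally show ?thesis .
qed

lemma sum_min_diff:
  fixes m :: nat
  shows "(\<Sum>k\<le>m. min k (m - k)) = m\<^sup>2 div 4"
proof (induction m rule: induct_nat_012)
  case (ge2 m)
  have "(\<Sum>k\<le>Suc (Suc m). min k (Suc (Suc m) - k)) = (\<Sum>k\<le>m. min (Suc k) (Suc m - k))"
    by (subst sum.atMost_Suc_shift) simp
  also have "\<dots> = (\<Sum>k\<le>m. min k (m - k) + 1)"
    by (intro sum.cong) auto
  also have "\<dots> = m\<^sup>2 div 4 + (m + 1)"
    unfolding sum.distrib ge2(1) by simp
  also have "\<dots> = (Suc (Suc m))\<^sup>2 div 4"
    by (simp add: power2_eq_square)
  finally show ?case .
qed auto

lemma sum_pivot_pairs_cost: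
  assumes "n \<ge> 2"
  shows "(\<Sum>(p, q)\<in>pivot_pairs n. real (q - p - 1) + real (min (p - 1) (n - q))) =
     real n * (real n - 1) / 2 * (real n / 2 - 5 / 4 + 1 / (4 * (real n - of_bool (even n))))"
proof -
  have "(\<Sum>(p, q)\<in>pivot_pairs n. real (q - p - 1) + real (min (p - 1) (n - q))) =
      (\<Sum>m<n - 1. \<Sum>k\<le>m. real (n - 2 - m) + real (min k (m - k)))"
    by (subst sum_pivot_pairs) (auto intro!: sum.cong simp: min_def)
  also have "\<dots> = (\<Sum>m<n - 1. (real m + 1) * (real n - 2 - real m) + real (m\<^sup>2 div 4))"
  proof (intro sum.cong refl)
    fix m assume "m \<in> {..<n - 1}"
    then have "real (n - 2 - m) = real n - 2 - real m" by auto
    then show "(\<Sum>k\<le>m. real (n - 2 - m) + real (min k (m - k))) =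
        (real m + 1) * (real n - 2 - real m) + real (m\<^sup>2 div 4)"
      by (simp only: sum.distrib sum_constant card_atMost of_nat_Suc flip: of_nat_sum sum_min_diff)
        (simp add: algebra_simps)
  qed
  also have "\<dots> = (\<Sum>m<n - 1. (real m + 1) * (real n - 2 - real m) + (real m ^ 2 - of_bool (odd m)) / 4)"
  proof (intro sum.cong refl)
    fix m :: nat
    have "real (m\<^sup>2 div 4) = (real m ^ 2 - of_bool (odd m)) / 4"
    proof (cases "even m")
      case True
      then show ?thesis by (auto elim!: evenE simp: power2_eq_square)
    next
      case False
      then obtain j where "m = 2 * j + 1" by (auto elim: oddE)
      moreover have "(2 * j + 1)\<^sup>2 div 4 = j * (j + 1)" by (simp add: power2_eq_square algebra_simps)
      ultimately show ?thesis by (simp add: power2_eq_square field_simps)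
    qed
    then show "(real m + 1) * (real n - 2 - real m) + real (m\<^sup>2 div 4) =
      (real m + 1) * (real n - 2 - real m) + (real m ^ 2 - of_bool (odd m)) / 4" by simp
  qed
  also have "\<dots> = real n * (real n - 1) / 2 * (real n / 2 - 5 / 4 + 1 / (4 * (real n - of_bool (even n))))"
  proof -
    have S: "(\<Sum>m<k. (real m + 1) * (x - 2 - real m) + (real m ^ 2 - of_bool (odd m)) / 4) =
        (x - 2) * real k * (real k + 1) / 2 - (real k - 1) * real k * (real k + 1) / 3
        + (real k - 1) * real k * (2 * real k - 1) / 24 - (real k - of_bool (odd k)) / 8" for k x
    proof (induction k)
      case (Suc k)
      show ?case
        unfolding sum.lessThan_Suc Suc
        by (cases "even k") (simp_all add: field_simps power2_eq_square)
    qed simp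
    have k: "real (n - 1) = real n - 1" "odd (n - 1) \<longleftrightarrow> even n" "real n - 1 \<noteq> 0" "real n \<noteq> 0"
      using assms by auto
    define x where "x = real n"
    show ?thesis
      using k(3,4) unfolding S k(1,2) x_def[symmetric]
      by (cases "even n") (simp_all add: field_simps)
  qed
  finally show ?thesis .
qed

lemma card_classes:
  assumes "1 \<le> p" "p < q" "q \<le> n"
  shows "card {y \<in> {1..n} - {p, q}. y < p} = p - 1"
    and "card {y \<in> {1..n} - {p, q}. q < y} = n - q"
    and "card {y \<in> {1..n} - {p, q}. p \<le> y \<and> y \<le> q} = q - p - 1"
proof -
  have "{y \<in> {1..n} - {p, q}. y < p} = {1..<p}" "{y \<in> {1..n} - {p, q}. q < y} = {q<..n}"
    "{y \<in> {1..n} - {p, q}. p \<le> y \<and> y \<le> q} = {p<..<q}"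
    using assms by auto
  then show "card {y \<in> {1..n} - {p, q}. y < p} = p - 1" "card {y \<in> {1..n} - {p, q}. q < y} = n - q"
    "card {y \<in> {1..n} - {p, q}. p \<le> y \<and> y \<le> q} = q - p - 1"
    by simp_all
qed

lemma length_filter_permutation:
  assumes "ys \<in> permutations_of_set A"
  shows "length (filter P ys) = card {y \<in> A. P y}"
proof -
  have "length (filter P ys) = card (set (filter P ys))"
    using permutations_of_setD(2)[OF assms] by (intro distinct_card[symmetric] distinct_filter)
  then show ?thesis
    using permutations_of_setD(1)[OF assms] by (simp add: Int_def)
qed

lemma card_middle_prefix:
  assumes "j \<le> length ys"
  shows "card {i \<in> {1..j}. P ((a # ys @ [b]) ! i)} = length (filter P (take j ys))"
proof -
  have "{i \<in> {1..j}. P ((a # ys @ [b]) ! i)} = Suc ` {i. i < length (take j ys) \<and> P (take j ys ! i)}"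
    (is "?L = ?R")
  proof (rule set_eqI)
    fix i show "i \<in> ?L \<longleftrightarrow> i \<in> ?R"
      using assms by (cases i) (auto simp: nth_append)
  qed
  then show ?thesis
    by (simp add: card_image length_filter_conv_card)
qed

lemma partition_comparisons_ends:
  "partition_comparisons strat (a # ys @ [b]) =
    1 + (\<Sum>j<length ys. classification_cost (min a b) (max a b) (strat (a # ys @ [b]) (j + 1)) (ys ! j))"
proof -
  have "(\<Sum>i = 1..length ys. classification_cost (min a b) (max a b) (strat (a # ys @ [b]) i) ((a # ys @ [b]) ! i)) =
        (\<Sum>j<length ys. classification_cost (min a b) (max a b) (strat (a # ys @ [b]) (j + 1)) (ys ! j))"
    by (rule sum.reindex_bij_witness[of _ Suc "\<lambda>i. i - 1"]) (auto simp: nth_append)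
  then show ?thesis
    by (simp add: partition_comparisons_def pivot_p_def pivot_q_def)
qed

context
  fixes n a b p q :: nat and ys :: "nat list"
  assumes ab: "a \<in> {1..n}" "b \<in> {1..n}" "a \<noteq> b"
    and ys: "ys \<in> permutations_of_set ({1..n} - {a, b})"
  defines "p \<equiv> min a b" and "q \<equiv> max a b"
begin

lemma pivots: "1 \<le> p" "p < q" "q \<le> n"
  using ab by (auto simp: p_def q_def)

lemma class_lengths:
  "length ys = n - 2"
  "length (filter (\<lambda>y. y < p) ys) = p - 1"
  "length (filter (\<lambda>y. q < y) ys) = n - q"
  "length (filter (\<lambda>y. p \<le> y \<and> y \<le> q) ys) = q - p - 1"
proof -
  have "{a, b} = {p, q}" by (auto simp: p_def q_def min_def max_def)
  with ys have ys': "ys \<in> permutations_of_set ({1..n} - {p, q})" by simp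
  show "length ys = n - 2"
    using length_finite_permutations_of_set[OF ys] ab by (simp add: card_Diff_subset)
  show "length (filter (\<lambda>y. y < p) ys) = p - 1" "length (filter (\<lambda>y. q < y) ys) = n - q"
    "length (filter (\<lambda>y. p \<le> y \<and> y \<le> q) ys) = q - p - 1"
    unfolding length_filter_permutation[OF ys'] using card_classes pivots by blast+
qed

lemma seen_in_prefix:
  assumes "j \<le> length ys"
  shows "small_seen (a # ys @ [b]) j = length (filter (\<lambda>y. y < p) (take j ys))"
    and "large_seen (a # ys @ [b]) j = length (filter (\<lambda>y. q < y) (take j ys))"
  using card_middle_prefix[OF assms, of "\<lambda>y. y < p"] card_middle_prefix[OF assms, of "\<lambda>y. q < y"]
  by (simp_all add: small_seen_def large_seen_def pivot_p_def pivot_q_def p_def q_def)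

lemma partition_comparisons_clairvoyant:
  "partition_comparisons clairvoyant (a # ys @ [b]) + down_from_zero (heights (class_word p q ys)) =
     n - 1 + (q - p - 1) + min (p - 1) (n - q)"
proof -
  have n: "n \<ge> 2" using pivots by simp
  have "clairvoyant (a # ys @ [b]) (j + 1) \<longleftrightarrow>
      length (filter (\<lambda>y. q < y) (drop j ys)) \<le> length (filter (\<lambda>y. y < p) (drop j ys))"
    if "j < length ys" for j
  proof -
    have split: "length (filter P ys) = length (filter P (take j ys)) + length (filter P (drop j ys))" for P
      by (metis append_take_drop_id filter_append length_append)
    have "small_total (a # ys @ [b]) = length (filter (\<lambda>y. y < p) ys)"
      "large_total (a # ys @ [b]) = length (filter (\<lambda>y. q < y) ys)"
      unfolding class_lengths using n class_lengths(1)
      by (simp_all add: small_total_def large_total_def pivot_p_def pivot_q_def p_def q_def)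
    then show ?thesis
      using seen_in_prefix[of j] that by (simp add: clairvoyant_def split)
  qed
  then have pc: "partition_comparisons clairvoyant (a # ys @ [b]) = 1 + (\<Sum>j<length ys. classification_cost p q
      (length (filter (\<lambda>y. q < y) (drop j ys)) \<le> length (filter (\<lambda>y. y < p) (drop j ys))) (ys ! j))"
    unfolding partition_comparisons_ends p_def[symmetric] q_def[symmetric] by simp
  have "n - 1 = 1 + (n - 2)"
    using n by simp
  with suffix_cost[OF pivots(2), of ys] show ?thesis
    unfolding pc class_lengths by (simp only: add.assoc)
qed

lemma partition_comparisons_count:
  "partition_comparisons count_strategy (a # ys @ [b]) =
     n - 1 + (q - p - 1) + min (p - 1) (n - q) + up_to_zero (heights (rev (class_word p q ys)))"
proof -
  have n: "n \<ge> 2" using pivots by simp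
  have "count_strategy (a # ys @ [b]) (j + 1) \<longleftrightarrow>
      length (filter (\<lambda>y. q < y) (take j ys)) \<le> length (filter (\<lambda>y. y < p) (take j ys))"
    if "j < length ys" for j
    using seen_in_prefix[of j] that by (simp add: count_strategy_def)
  then have pc: "partition_comparisons count_strategy (a # ys @ [b]) = 1 + (\<Sum>j<length ys. classification_cost p q
      (length (filter (\<lambda>y. q < y) (take j ys)) \<le> length (filter (\<lambda>y. y < p) (take j ys))) (ys ! j))"
    unfolding partition_comparisons_ends p_def[symmetric] q_def[symmetric] by simp
  have "n - 1 = 1 + (n - 2)"
    using n by simp
  with prefix_cost[OF pivots(2), of ys] show ?thesis
    unfolding pc class_lengths by (simp only: add.assoc)
qed

end

lemma expected_cost_via_paths:
  fixes c :: real and X :: "int list \<Rightarrow> nat" and \<pi> :: "nat \<Rightarrow> nat \<Rightarrow> nat list \<Rightarrow> int list"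
  assumes n: "n \<ge> 2"
    and \<pi>: "\<And>p q. 1 \<le> p \<Longrightarrow> p < q \<Longrightarrow> q \<le> n \<Longrightarrow>
        map_pmf (\<pi> p q) (pmf_of_set (permutations_of_set ({1..n} - {p, q}))) =
        pmf_of_set (lattice_paths (n - 1 - (q - p)) (int (p - 1) - int (n - q)))"
    and F: "\<And>a b ys. a \<in> {1..n} \<Longrightarrow> b \<in> {1..n} \<Longrightarrow> a \<noteq> b \<Longrightarrow> ys \<in> permutations_of_set ({1..n} - {a, b}) \<Longrightarrow>
        real (F (a # ys @ [b])) = real n - 1 + real (max a b - min a b - 1) + real (min (min a b - 1) (n - max a b))
          + c * real (X (\<pi> (min a b) (max a b) ys))"
  shows "expected (map_pmf F (random_input n)) =
    3 / 2 * real n - 9 / 4 + 1 / (4 * (real n - of_bool (even n))) + c * expected (map_pmf X (random_pivot_path n))"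
proof -
  let ?C = "real (card (pivot_pairs n))"
  let ?U = "\<lambda>p q. pmf_of_set (permutations_of_set ({1..n} - {p, q}))"
  let ?V = "\<lambda>p q. measure_pmf.expectation
    (pmf_of_set (lattice_paths (n - 1 - (q - p)) (int (p - 1) - int (n - q)))) (\<lambda>w. real (X w))"
  let ?k = "\<lambda>p q. real (q - p - 1) + real (min (p - 1) (n - q))"
  have C: "?C = real n * (real n - 1) / 2" "?C \<noteq> 0"
    unfolding card_pivot_pairs using n by simp_all
  have E: "measure_pmf.expectation (?U p q) (\<lambda>ys. real n - 1 + ?k p q + c * real (X (\<pi> p q ys))) =
      (real n - 1) + ?k p q + c * ?V p q"
    if "(p, q) \<in> pivot_pairs n" for p q
  proof -
    have int: "integrable (measure_pmf (?U p q)) f" for f :: "nat list \<Rightarrow> real"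
      by (intro integrable_measure_pmf_finite) simp
    have "measure_pmf.expectation (?U p q) (\<lambda>ys. real (X (\<pi> p q ys))) =
        measure_pmf.expectation (map_pmf (\<pi> p q) (?U p q)) (\<lambda>w. real (X w))"
      by simp
    also have "\<dots> = ?V p q"
      using that by (subst \<pi>) auto
    finally have V: "measure_pmf.expectation (?U p q) (\<lambda>ys. real (X (\<pi> p q ys))) = ?V p q" .
    show ?thesis
      unfolding V[symmetric]
      by (subst Bochner_Integration.integral_add) (use int in \<open>simp_all\<close>)
  qed
  have "expected (map_pmf F (random_input n)) = (\<Sum>(p, q)\<in>pivot_pairs n. measure_pmf.expectation (?U p q)
      (\<lambda>ys. real n - 1 + ?k p q + c * real (X (\<pi> p q ys)))) / ?C"
    using n F by (intro expected_random_input) (auto simp: add.assoc)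
  also have "\<dots> = (\<Sum>(p, q)\<in>pivot_pairs n. (real n - 1) + ?k p q + c * ?V p q) / ?C"
    using E by (intro arg_cong2[where f = "(/)"] sum.cong) auto
  also have "\<dots> = (real n - 1) + (\<Sum>(p, q)\<in>pivot_pairs n. ?k p q) / ?C + c * ((\<Sum>(p, q)\<in>pivot_pairs n. ?V p q) / ?C)"
    using C(2) by (simp only: case_prod_unfold sum.distrib sum_constant sum_distrib_left[symmetric]
        add_divide_distrib nonzero_mult_div_cancel_left times_divide_eq_right not_False_eq_True)
  also have "(\<Sum>(p, q)\<in>pivot_pairs n. ?V p q) / ?C = expected (map_pmf X (random_pivot_path n))"
    using expectation_random_pivot_path[OF n, of "\<lambda>w. real (X w)"] by (simp add: expected_def)
  also have "(\<Sum>(p, q)\<in>pivot_pairs n. ?k p q) / ?C = real n / 2 - 5 / 4 + 1 / (4 * (real n - of_bool (even n)))"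
    unfolding sum_pivot_pairs_cost[OF n] C(1)[symmetric]
    using C(2) by (rule nonzero_mult_div_cancel_left)
  finally show ?thesis by simp
qed

theorem lemmaJ1:
  fixes n :: nat
  assumes "n \<ge> 2"
  shows "expected (P_cv n) =
           3 / 2 * real n - 9 / 4 + 1 / (4 * (real n - of_bool (even n))) - expected (X_down n)
       \<and> expected (P_ct n) =
           3 / 2 * real n - 9 / 4 + 1 / (4 * (real n - of_bool (even n))) + expected (X_up n)"
proof
  note law = map_pmf_heights_class_word[of "{1..n} - {p, q}" p q for p q]
  have len: "p - 1 + (n - q) = n - 1 - (q - p)" if "1 \<le> p" "p < q" "q \<le> n" for p q
    using that by simp
  have "expected (P_cv n) = 3 / 2 * real n - 9 / 4 + 1 / (4 * (real n - of_bool (even n)))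
      + (- 1) * expected (map_pmf down_from_zero (random_pivot_path n))"
    unfolding P_cv_def
  proof (rule expected_cost_via_paths[OF assms, where \<pi> = "\<lambda>p q ys. heights (class_word p q ys)"])
    fix p q assume pq: "1 \<le> p" "p < q" "q \<le> n"
    show "map_pmf (\<lambda>ys. heights (class_word p q ys)) (pmf_of_set (permutations_of_set ({1..n} - {p, q}))) =
        pmf_of_set (lattice_paths (n - 1 - (q - p)) (int (p - 1) - int (n - q)))"
      using law(1)[of p q] pq unfolding card_classes[OF pq] len[OF pq] by simp
  next
    fix a b ys
    assume "a \<in> {1..n}" "b \<in> {1..n}" "a \<noteq> b" "ys \<in> permutations_of_set ({1..n} - {a, b})"
    from arg_cong[OF partition_comparisons_clairvoyant[OF this], of real]
    show "real (partition_comparisons clairvoyant (a # ys @ [b])) =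
        real n - 1 + real (max a b - min a b - 1) + real (min (min a b - 1) (n - max a b))
        + - 1 * real (down_from_zero (heights (class_word (min a b) (max a b) ys)))"
      using assms by (simp only: of_nat_add of_nat_diff)
  qed
  then show "expected (P_cv n) =
      3 / 2 * real n - 9 / 4 + 1 / (4 * (real n - of_bool (even n))) - expected (X_down n)"
    by (simp add: X_down_def)
  have "expected (P_ct n) = 3 / 2 * real n - 9 / 4 + 1 / (4 * (real n - of_bool (even n)))
      + 1 * expected (map_pmf up_to_zero (random_pivot_path n))"
    unfolding P_ct_def
  proof (rule expected_cost_via_paths[OF assms, where \<pi> = "\<lambda>p q ys. heights (rev (class_word p q ys))"])
    fix p q assume pq: "1 \<le> p" "p < q" "q \<le> n"
    show "map_pmf (\<lambda>ys. heights (rev (class_word p q ys))) (pmf_of_set (permutations_of_set ({1..n} - {p, q}))) =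
        pmf_of_set (lattice_paths (n - 1 - (q - p)) (int (p - 1) - int (n - q)))"
      using law(2)[of p q] pq unfolding card_classes[OF pq] len[OF pq] by simp
  next
    fix a b ys
    assume "a \<in> {1..n}" "b \<in> {1..n}" "a \<noteq> b" "ys \<in> permutations_of_set ({1..n} - {a, b})"
    from arg_cong[OF partition_comparisons_count[OF this], of real]
    show "real (partition_comparisons count_strategy (a # ys @ [b])) =
        real n - 1 + real (max a b - min a b - 1) + real (min (min a b - 1) (n - max a b))
        + 1 * real (up_to_zero (heights (rev (class_word (min a b) (max a b) ys))))"
      using assms by (simp only: of_nat_add of_nat_diff)
  qed
  then show "expected (P_ct n) =
      3 / 2 * real n - 9 / 4 + 1 / (4 * (real n - of_bool (even n))) + expected (X_up n)"
    by (simp add: X_up_def)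
qed

end
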